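(* In $\mathbb Z[\Gamma^2]$ one has $I_H\cap I_V\cap I_D=\mathcal I_2$, i.e. the left ideal $I_H\cap I_V\cap I_D$ is generated by the four elements $(1+S,1+S)$, $(S,S)+(S,US)+(US,US)+(1,U)-(U^2,U^2)$, $(1+U+U^2,1)[(1,1)+(S,S)]$ and $(1,1+U+U^2)[(1,1)+(S,S)]$.
   Context: $\Gamma=PSL_2(\mathbb Z)$ acting on $\mathbb P^1(\mathbb Q)$ by Möbius transformations; $S=\pm\begin{pmatrix}0&-1\\1&0\end{pmatrix}$, $U=\pm\begin{pmatrix}0&1\\-1&1\end{pmatrix}$, $T=\pm\begin{pmatrix}1&1\\0&1\end{pmatrix}$. Identify $\mathbb Z[\Gamma^2]=\mathbb Z[\Gamma]\otimes\mathbb Z[\Gamma]$, writing $(a,b)=a\otimes b$ for $a,b\in\mathbb Z[\Gamma]$ (products componentwise). $\mathcal I_2$ denotes the left ideal generated by the four listed elements. Let $\Gamma_\infty=\{T^n\}$ and $\Gamma_0=\{(US)^n\}$ be the stabilizers of $\infty$ and $0$. For $\gamma\in\Gamma$ put $\partial\gamma=[\gamma\infty]-[\gamma0]\in\mathbb Z[\mathbb P^1(\mathbb Q)]$. Write an element of $\mathbb Z[\Gamma^2]$ as $\sum_i\lambda_i(\alpha_i,\beta_i)$ with distinct pairs $(\alpha_i,\beta_i)\in\Gamma^2$. Define $I_H$ as the set of such elements with $\sum_{i:\beta_i\in C}\lambda_i\,\partial\alpha_i=0$ for every coset $C\in\Gamma/\Gamma_\infty$; $I_V$ as those with $\sum_{i:\alpha_i\in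 C}\lambda_i\,\partial\beta_i=0$ for every coset $C\in\Gamma/\Gamma_0$; and $I_D$ as those with $\sum_{i:\beta_i\alpha_i^{-1}=g}\lambda_i\,\partial\alpha_i=0$ for every $g\in\Gamma$. (These encode that $g$ maps the horizontal path from $(\infty,\infty)$ to $(0,\infty)$, the vertical path from $(0,\infty)$ to $(0,0)$, resp. the diagonal path from $(\infty,\infty)$ to $(0,0)$ in $(\mathbb H\cup\mathbb P^1(\mathbb Q))^2$, to closed chains of the same type.) *)

theory Defs
  imports Complex_Main "HOL-Library.Function_Algebras"
begin

text \<open>A matrix (a,b,c,d) stands for [[a,b],[c,d]].  Elements of PSL_2(Z) are
represented by the unique representative of {M,-M} with c > 0, or c = 0 and d > 0.\<close>

type_synonym mat = "int \<times> int \<times> int \<times> int"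

definition normal_mat :: "mat \<Rightarrow> bool" where
  "normal_mat m = (case m of (a,b,c,d) \<Rightarrow> a*d - b*c = 1 \<and> (c > 0 \<or> (c = 0 \<and> d > 0)))"

definition pnorm :: "mat \<Rightarrow> mat" where
  "pnorm m = (case m of (a,b,c,d) \<Rightarrow>
     if c > 0 \<or> (c = 0 \<and> d > 0) then (a,b,c,d) else (-a,-b,-c,-d))"

definition mmul :: "mat \<Rightarrow> mat \<Rightarrow> mat" where
  "mmul m n = (case m of (a,b,c,d) \<Rightarrow> case n of (e,f,g,h) \<Rightarrow>
     (a*e + b*g, a*f + b*h, c*e + d*g, c*f + d*h))"

typedef psl = "{m. normal_mat m}"
  by (rule exI[of _ "(1,0,0,1)"]) (simp add: normal_mat_def)

instantiation psl :: "{times, one, inverse}"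
begin
definition "x * y = Abs_psl (pnorm (mmul (Rep_psl x) (Rep_psl y)))"
definition "1 = Abs_psl (1,0,0,1)"
definition "inverse x = (case Rep_psl x of (a,b,c,d) \<Rightarrow> Abs_psl (pnorm (d,-b,-c,a)))"
definition "divide x y = x * inverse (y::psl)"
instance ..
end

definition gpown :: "psl \<Rightarrow> nat \<Rightarrow> psl" where
  "gpown g n = ((\<lambda>x. g * x) ^^ n) 1"

definition gpow :: "psl \<Rightarrow> int \<Rightarrow> psl" where
  "gpow g n = (if n \<ge> 0 then gpown g (nat n) else gpown (inverse g) (nat (-n)))"

definition S :: psl where "S = Abs_psl (pnorm (0,-1,1,0))"
definition U :: psl where "U = Abs_psl (pnorm (0,1,-1,1))"
definition T :: psl where "T = Abs_psl (pnorm (1,1,0,1))"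

definition Gamma_inf :: "psl set" where "Gamma_inf = {g. \<exists>n. g = gpow T n}"
definition Gamma_0 :: "psl set" where "Gamma_0 = {g. \<exists>n. g = gpow (U * S) n}"

definition lcoset :: "psl \<Rightarrow> psl set \<Rightarrow> psl set" where
  "lcoset g H = (\<lambda>h. g * h) ` H"

section \<open>Moebius action on P^1(Q) = rat option (None = infinity)\<close>

definition mobius :: "psl \<Rightarrow> rat option \<Rightarrow> rat option" where
  "mobius g x = (case Rep_psl g of (a,b,c,d) \<Rightarrow>
     (case x of
        None \<Rightarrow> (if c = 0 then None else Some (of_int a / of_int c))
      | Some q \<Rightarrow> (if of_int c * q + of_int d = 0 then None
                  else Some ((of_int a * q + of_int b) / (of_int c * q + of_int d)))))"

text \<open>Elements of Z[P^1(Q)] as (finitely supported) functions to int;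
  [x] is the indicator of x.\<close>
definition pt :: "rat option \<Rightarrow> rat option \<Rightarrow> int" where
  "pt x = (\<lambda>y. if y = x then 1 else 0)"

definition bdry :: "psl \<Rightarrow> rat option \<Rightarrow> int" where
  "bdry g = (\<lambda>y. pt (mobius g None) y - pt (mobius g (Some 0)) y)"

definition fin_supp :: "('a \<Rightarrow> int) \<Rightarrow> bool" where
  "fin_supp f = finite {x. f x \<noteq> 0}"

definition ZG :: "(psl \<Rightarrow> int) set" where "ZG = {f. fin_supp f}"
definition ZG2 :: "(psl \<times> psl \<Rightarrow> int) set" where "ZG2 = {f. fin_supp f}"

definition delta :: "'a \<Rightarrow> 'a \<Rightarrow> int" where
  "delta g = (\<lambda>x. if x = g then 1 else 0)"

definition conv :: "('a \<Rightarrow> 'a \<Rightarrow> 'a) \<Rightarrow> ('a \<Rightarrow> int) \<Rightarrow> ('a \<Rightarrow> int) \<Rightarrow> 'a \<Rightarrow> int" where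
  "conv m f h z = (\<Sum>(x,y) \<in> {(x,y). f x \<noteq> 0 \<and> h y \<noteq> 0 \<and> m x y = z}. f x * h y)"

definition pmul2 :: "psl \<times> psl \<Rightarrow> psl \<times> psl \<Rightarrow> psl \<times> psl" where
  "pmul2 p q = (fst p * fst q, snd p * snd q)"

definition mul1 :: "(psl \<Rightarrow> int) \<Rightarrow> (psl \<Rightarrow> int) \<Rightarrow> psl \<Rightarrow> int" where
  "mul1 = conv (*)"
definition mul2 :: "(psl \<times> psl \<Rightarrow> int) \<Rightarrow> (psl \<times> psl \<Rightarrow> int) \<Rightarrow> psl \<times> psl \<Rightarrow> int" where
  "mul2 = conv pmul2"

text \<open>The identification Z[Gamma^2] = Z[Gamma] (x) Z[Gamma]: (a,b) = a (x) b.\<close>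
definition tens :: "(psl \<Rightarrow> int) \<Rightarrow> (psl \<Rightarrow> int) \<Rightarrow> psl \<times> psl \<Rightarrow> int" where
  "tens a b = (\<lambda>(x,y). a x * b y)"


definition gen1 where "gen1 = tens (delta 1 + delta S) (delta 1 + delta S)"
definition gen2 where
  "gen2 = tens (delta S) (delta S) + tens (delta S) (delta (U*S)) + tens (delta (U*S)) (delta (U*S))
          + tens (delta 1) (delta U) - tens (delta (U*U)) (delta (U*U))"
definition gen3 where
  "gen3 = mul2 (tens (delta 1 + delta U + delta (U*U)) (delta 1))
               (tens (delta 1) (delta 1) + tens (delta S) (delta S))"
definition gen4 where
  "gen4 = mul2 (tens (delta 1) (delta 1 + delta U + delta (U*U)))
               (tens (delta 1) (delta 1) + tens (delta S) (delta S))"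

definition I2 :: "(psl \<times> psl \<Rightarrow> int) set" where
  "I2 = {f. \<exists>r1 r2 r3 r4. r1 \<in> ZG2 \<and> r2 \<in> ZG2 \<and> r3 \<in> ZG2 \<and> r4 \<in> ZG2 \<and>
           f = mul2 r1 gen1 + mul2 r2 gen2 + mul2 r3 gen3 + mul2 r4 gen4}"

text \<open>For f = sum lambda_i (alpha_i,beta_i) with distinct pairs, lambda_i = f(alpha_i,beta_i);
  the sum over pairs with nonzero coefficient.\<close>
definition I_H :: "(psl \<times> psl \<Rightarrow> int) set" where
  "I_H = {f \<in> ZG2. \<forall>g. (\<lambda>p. \<Sum>(a,b) \<in> {(a,b). f (a,b) \<noteq> 0 \<and> b \<in> lcoset g Gamma_inf}.
                              f (a,b) * bdry a p) = (\<lambda>_. 0)}"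

definition I_V :: "(psl \<times> psl \<Rightarrow> int) set" where
  "I_V = {f \<in> ZG2. \<forall>g. (\<lambda>p. \<Sum>(a,b) \<in> {(a,b). f (a,b) \<noteq> 0 \<and> a \<in> lcoset g Gamma_0}.
                              f (a,b) * bdry b p) = (\<lambda>_. 0)}"

definition I_D :: "(psl \<times> psl \<Rightarrow> int) set" where
  "I_D = {f \<in> ZG2. \<forall>g. (\<lambda>p. \<Sum>(a,b) \<in> {(a,b). f (a,b) \<noteq> 0 \<and> b * inverse a = g}.
                              f (a,b) * bdry a p) = (\<lambda>_. 0)}"

end

theory Submission
  imports Defs
begin

text \<open>Write \<open>\<sigma> = (1,1) + (S,S)\<close>, whose two triangles form the square with corners
  \<open>{\<infinity>, 0}\<^sup>2\<close>, and \<open>\<tau> = (1,1) + (U,U) + (U\<^sup>2,U\<^sup>2)\<close>. The second generator equals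
  \<open>((1,1) + (U,U) + (1,U)) \<sigma> - \<tau>\<close>, and by Manin's relations \<open>I_D\<close> is generated by \<open>\<sigma>\<close> and
  \<open>\<tau>\<close>; hence modulo \<open>\<I>\<^sub>2\<close> every element of \<open>I_D\<close> has the form \<open>c \<sigma>\<close>. Such an element lies
  in \<open>I_H\<close> precisely when \<open>\<partial> \<otimes> \<partial>\<close> kills \<open>c\<close>. By Manin's relations in each variable, this forces \<open>c\<close>
  into the left ideal generated by \<open>(1 + S, 1)\<close>, \<open>(1, 1 + S)\<close>, \<open>(1 + U + U\<^sup>2, 1)\<close> and
  \<open>(1, 1 + U + U\<^sup>2)\<close>, and the products of these with \<open>\<sigma>\<close> are the first, first, third and fourth
  generators.

  Manin's relations are used in the form that every \<open>\<gamma>\<close> is congruent to a path from \<open>\<infinity>\<close> to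
  \<open>\<gamma> \<infinity>\<close> minus one from \<open>\<infinity>\<close> to \<open>\<gamma> 0\<close>, where the path to a cusp is fixed once and for all.\<close>

section \<open>The modular group\<close>

text \<open>The class in PSL_2(Z) of any integer matrix of determinant 1, so that computations may
  use whichever of the two signs is convenient.\<close>

definition of_mat :: "mat \<Rightarrow> psl" where
  "of_mat m = Abs_psl (pnorm m)"

lemma normal_mat_pnorm:
  assumes "a * d - b * c = (1::int)"
  shows "normal_mat (pnorm (a, b, c, d))"
proof -
  have "d \<noteq> 0" if "c = 0" using assms that by auto
  then show ?thesis using assms by (auto simp: normal_mat_def pnorm_def)
qed

lemma Rep_of_mat:
  assumes "a * d - b * c = (1::int)"
  shows "Rep_psl (of_mat (a, b, c, d)) = pnorm (a, b, c, d)"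
  unfolding of_mat_def using normal_mat_pnorm[OF assms] by (simp add: Abs_psl_inverse)

lemma of_mat_minus:
  assumes "a * d - b * c = (1::int)"
  shows "of_mat (-a, -b, -c, -d) = of_mat (a, b, c, d)"
proof -
  have "d \<noteq> 0" if "c = 0" using assms that by auto
  then show ?thesis by (auto simp: of_mat_def pnorm_def)
qed

lemma psl_cases:
  obtains a b c d where "x = of_mat (a, b, c, d)" "a * d - b * c = 1" "c > 0 \<or> c = 0 \<and> d > 0"
proof -
  obtain a b c d where r: "Rep_psl x = (a, b, c, d)" by (cases "Rep_psl x") auto
  have n: "normal_mat (a, b, c, d)" using Rep_psl[of x] r by simp
  have "x = Abs_psl (a, b, c, d)" using r by (metis Rep_psl_inverse)
  also have "\<dots> = of_mat (a, b, c, d)" using n by (auto simp: of_mat_def pnorm_def normal_mat_def)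
  finally show ?thesis using n that by (auto simp: normal_mat_def)
qed

lemma det_mmul:
  fixes a b c d e f g h :: int
  assumes "a * d - b * c = 1" "e * h - f * g = 1"
  shows "(a * e + b * g) * (c * f + d * h) - (a * f + b * h) * (c * e + d * g) = 1"
proof -
  have "(a * e + b * g) * (c * f + d * h) - (a * f + b * h) * (c * e + d * g)
      = (a * d - b * c) * (e * h - f * g)" by (simp add: algebra_simps)
  then show ?thesis using assms by simp
qed

text \<open>Normalizing either factor changes the matrix product at most by a sign, which
  \<open>of_mat\<close> ignores.\<close>

lemma of_mat_mult:
  assumes "a * d - b * c = (1::int)" "e * h - f * g = 1"
  shows "of_mat (a, b, c, d) * of_mat (e, f, g, h)
    = of_mat (a * e + b * g, a * f + b * h, c * e + d * g, c * f + d * h)"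
proof -
  have "pnorm (a, b, c, d) = (a, b, c, d) \<or> pnorm (a, b, c, d) = (-a, -b, -c, -d)"
    "pnorm (e, f, g, h) = (e, f, g, h) \<or> pnorm (e, f, g, h) = (-e, -f, -g, -h)"
    by (simp_all add: pnorm_def)
  moreover have "of_mat (a, b, c, d) * of_mat (e, f, g, h)
    = of_mat (mmul (pnorm (a, b, c, d)) (pnorm (e, f, g, h)))"
    unfolding times_psl_def Rep_of_mat[OF assms(1)] Rep_of_mat[OF assms(2)] by (simp add: of_mat_def)
  ultimately show ?thesis
    using of_mat_minus[OF det_mmul[OF assms]] by (elim disjE) (simp_all add: mmul_def minus_diff_commute)
qed

lemma one_psl_eq: "1 = of_mat (1, 0, 0, 1)"
  by (simp add: one_psl_def of_mat_def pnorm_def)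

lemma S_eq: "S = of_mat (0, -1, 1, 0)" by (simp add: S_def of_mat_def)
lemma U_eq: "U = of_mat (0, 1, -1, 1)" by (simp add: U_def of_mat_def)
lemma T_eq: "T = of_mat (1, 1, 0, 1)" by (simp add: T_def of_mat_def)

lemma inverse_of_mat:
  assumes "a * d - b * c = (1::int)"
  shows "inverse (of_mat (a, b, c, d)) = of_mat (d, -b, -c, a)"
proof -
  have "of_mat (-d, b, c, -a) = of_mat (d, -b, -c, a)"
    using of_mat_minus[of d a "-b" "-c"] assms by (simp add: mult.commute)
  then show ?thesis
    unfolding inverse_psl_def Rep_of_mat[OF assms]
    by (auto simp: pnorm_def of_mat_def)
qed

instance psl :: monoid_mult
proof
  fix x y z :: psl
  obtain a b c d where x: "x = of_mat (a, b, c, d)" "a * d - b * c = 1" by (rule psl_cases)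
  obtain e f g h where y: "y = of_mat (e, f, g, h)" "e * h - f * g = 1" by (rule psl_cases)
  obtain p q r s where z: "z = of_mat (p, q, r, s)" "p * s - q * r = 1" by (rule psl_cases)
  show "x * y * z = x * (y * z)"
    by (simp add: x(1) y(1) z(1) of_mat_mult[OF x(2) y(2)] of_mat_mult[OF y(2) z(2)]
        of_mat_mult[OF det_mmul[OF x(2) y(2)] z(2)] of_mat_mult[OF x(2) det_mmul[OF y(2) z(2)]])
      (simp add: algebra_simps)
  show "1 * x = x" "x * 1 = x"
    using x by (simp_all add: one_psl_eq of_mat_mult)
qed

lemma psl_inverse:
  fixes x :: psl
  shows "x * inverse x = 1" "inverse x * x = 1"
proof -
  obtain a b c d where x: "x = of_mat (a, b, c, d)" "a * d - b * c = 1" by (rule psl_cases)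
  then show "x * inverse x = 1" "inverse x * x = 1"
    by (simp_all add: inverse_of_mat of_mat_mult one_psl_eq mult.commute)
qed

lemma psl_mult_right_cancel: "x * z = y * z \<longleftrightarrow> x = (y::psl)"
  by (metis mult.assoc mult.right_neutral psl_inverse(1))

lemma psl_mult_inverse_eq_iff: "b * inverse a = g \<longleftrightarrow> b = g * (a::psl)"
  by (metis mult.assoc mult.right_neutral psl_inverse)

lemma S_S: "S * S = 1"
  using of_mat_minus[of 1 1 0 0] by (simp add: S_eq one_psl_eq of_mat_mult)

lemma U_U: "U * U = of_mat (-1, 1, -1, 0)"
  by (simp add: U_eq of_mat_mult)

lemma U_U_U: "U * U * U = 1"
  using of_mat_minus[of 1 1 0 0] by (simp add: U_U) (simp add: U_eq one_psl_eq of_mat_mult)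

lemma mult_S_S [simp]: "x * S * S = x"
  by (simp add: mult.assoc S_S)

lemma mult_U_U_U [simp]: "x * U * U * U = x"
  by (metis mult.assoc U_U_U mult.right_neutral)

section \<open>Cusps\<close>

abbreviation cusp_inf :: "psl \<Rightarrow> rat option" where "cusp_inf g \<equiv> mobius g None"
abbreviation cusp_0 :: "psl \<Rightarrow> rat option" where "cusp_0 g \<equiv> mobius g (Some 0)"

lemma cusp_inf_of_mat:
  assumes "a * d - b * c = (1::int)"
  shows "cusp_inf (of_mat (a, b, c, d)) = (if c = 0 then None else Some (of_int a / of_int c))"
  by (simp add: mobius_def Rep_of_mat[OF assms] pnorm_def)

lemma cusp_0_of_mat:
  assumes "a * d - b * c = (1::int)"
  shows "cusp_0 (of_mat (a, b, c, d)) = (if d = 0 then None else Some (of_int b / of_int d))"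
  by (simp add: mobius_def Rep_of_mat[OF assms] pnorm_def)

lemma cusp_S [simp]: "cusp_inf (x * S) = cusp_0 x" "cusp_0 (x * S) = cusp_inf x"
proof -
  obtain a b c d where x: "x = of_mat (a, b, c, d)" "a * d - b * c = 1" by (rule psl_cases)
  then have "x * S = of_mat (b, -a, d, -c)" "b * (-c) - (-a) * d = 1"
    by (simp_all add: S_eq of_mat_mult mult.commute)
  with x show "cusp_inf (x * S) = cusp_0 x" "cusp_0 (x * S) = cusp_inf x"
    by (simp_all add: cusp_inf_of_mat cusp_0_of_mat)
qed

text \<open>\<open>U\<close> permutes \<infinity>, 0, 1 cyclically, so the edges \<open>x\<close>,
  \<open>x * U\<close>, \<open>x * U * U\<close> follow one another around a triangle.\<close>

lemma cusp_inf_U [simp]: "cusp_inf (x * U) = cusp_0 x"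
proof -
  obtain a b c d where x: "x = of_mat (a, b, c, d)" "a * d - b * c = 1" by (rule psl_cases)
  then have "x * U = of_mat (-b, a + b, -d, c + d)" "(-b) * (c + d) - (a + b) * (-d) = 1"
    by (simp_all add: U_eq of_mat_mult algebra_simps)
  with x show "cusp_inf (x * U) = cusp_0 x"
    by (simp add: cusp_inf_of_mat cusp_0_of_mat)
qed

lemma cusp_0_U_U [simp]: "cusp_0 (x * U * U) = cusp_inf x"
  by (metis cusp_inf_U mult_U_U_U)

lemma bdry_eq: "bdry g p = pt (cusp_inf g) p - pt (cusp_0 g) p"
  by (simp add: bdry_def)

section \<open>Cusps and cosets of their stabilizers\<close>

lemma of_rat_frac_eq:
  fixes a c a' c' :: int
  assumes "coprime a c" "coprime a' c'" "c > 0" "c' > 0"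
    and "(of_int a / of_int c :: rat) = of_int a' / of_int c'"
  shows "a = a' \<and> c = c'"
  using assms
  by (metis Fract_of_int_quotient fst_conv quotient_of_Fract normalize_stable snd_conv)

lemma coprime_of_det:
  assumes "a * d - b * c = (1::int)"
  shows "coprime a c" "coprime b d"
proof -
  have "a * d + c * (-b) = 1" "b * (-c) + d * a = 1" using assms by (simp_all add: algebra_simps)
  then show "coprime a c" "coprime b d"
    by (metis coprimeI dvd_add dvd_mult2 dvd_refl)+
qed

text \<open>Lowest terms and the sign normalization make the first columns equal; determinant 1 then
  forces the second columns to differ by a multiple of the first.\<close>

lemma cusp_inf_eqE:
  assumes "cusp_inf x = cusp_inf y"
  obtains n where "y = x * of_mat (1, n, 0, 1)"
proof -
  obtain a b c d where x: "x = of_mat (a, b, c, d)" "a * d - b * c = 1" "c > 0 \<or> c = 0 \<and> d > 0"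
    by (rule psl_cases)
  obtain a' b' c' d' where y: "y = of_mat (a', b', c', d')" "a' * d' - b' * c' = 1"
    "c' > 0 \<or> c' = 0 \<and> d' > 0"
    by (rule psl_cases)
  have eq: "a = a' \<and> c = c'"
  proof (cases "c = 0")
    case True
    then have "c' = 0" using assms x y by (simp add: cusp_inf_of_mat split: if_splits)
    moreover have "a = 1" "a' = 1"
      using True \<open>c' = 0\<close> x(2,3) y(2,3) by (auto simp: zmult_eq_1_iff)
    ultimately show ?thesis using True by simp
  next
    case False
    then have "c' \<noteq> 0" using assms x y by (simp add: cusp_inf_of_mat split: if_splits)
    then show ?thesis
      using False assms x y coprime_of_det[OF x(2)] coprime_of_det[OF y(2)]
      by (intro of_rat_frac_eq) (auto simp: cusp_inf_of_mat)
  qed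
  \<comment> \<open>The upper right entry of \<open>inverse x * y\<close>.\<close>
  define n where "n = d * b' - b * d'"
  have 1: "a * d - b * c = 1" "a * d' - b' * c = 1" using x y eq by auto
  have "a * n + b = (a * d - b * c) * b' + b * (1 - (a * d' - b' * c))"
    by (simp add: n_def algebra_simps)
  moreover have "c * n + d = (a * d - b * c) * d' + d * (1 - (a * d' - b' * c))"
    by (simp add: n_def algebra_simps)
  ultimately have "a * n + b = b'" "c * n + d = d'" using 1 by auto
  then have "y = x * of_mat (1, n, 0, 1)"
    using x y eq by (simp add: of_mat_mult)
  then show ?thesis by (rule that)
qed

lemma cusp_inf_mult_translation: "cusp_inf (x * of_mat (1, n, 0, 1)) = cusp_inf x"
proof -
  obtain a b c d where x: "x = of_mat (a, b, c, d)" "a * d - b * c = 1" by (rule psl_cases)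
  have "a * (c * n + d) - (a * n + b) * c = 1" using x(2) by (simp add: algebra_simps)
  then show ?thesis using x by (simp add: of_mat_mult cusp_inf_of_mat)
qed

lemma gpow_T: "gpow T n = of_mat (1, n, 0, 1)"
proof -
  have "gpown T k = of_mat (1, int k, 0, 1)" for k
    by (induction k) (simp_all add: gpown_def one_psl_eq T_eq of_mat_mult add.commute)
  moreover have "gpown (inverse T) k = of_mat (1, - int k, 0, 1)" for k
    by (induction k) (simp_all add: gpown_def one_psl_eq T_eq of_mat_mult inverse_of_mat algebra_simps)
  ultimately show ?thesis by (simp add: gpow_def)
qed

lemma U_S: "U * S = of_mat (1, 0, 1, 1)"
  by (simp add: U_eq S_eq of_mat_mult)

lemma gpow_U_S: "gpow (U * S) n = of_mat (1, 0, n, 1)"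
proof -
  have "gpown (U * S) k = of_mat (1, 0, int k, 1)" for k
    by (induction k) (simp_all add: gpown_def one_psl_eq U_S of_mat_mult)
  moreover have "gpown (inverse (U * S)) k = of_mat (1, 0, - int k, 1)" for k
    by (induction k) (simp_all add: gpown_def one_psl_eq U_S of_mat_mult inverse_of_mat)
  ultimately show ?thesis by (simp add: gpow_def)
qed

lemma mem_lcoset_Gamma_inf: "b \<in> lcoset g Gamma_inf \<longleftrightarrow> cusp_inf b = cusp_inf g"
proof
  assume "cusp_inf b = cusp_inf g"
  then obtain n where "b = g * of_mat (1, n, 0, 1)" using cusp_inf_eqE by metis
  then show "b \<in> lcoset g Gamma_inf" by (auto simp: lcoset_def Gamma_inf_def gpow_T)
qed (auto simp: lcoset_def Gamma_inf_def gpow_T cusp_inf_mult_translation)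

lemma mem_lcoset_Gamma_0: "a \<in> lcoset g Gamma_0 \<longleftrightarrow> cusp_0 a = cusp_0 g"
proof -
  \<comment> \<open>Conjugation by \<open>S\<close> exchanges the stabilizers of 0 and \<infinity>,
    which reduces the claim to cosets of \<open>Gamma_inf\<close>.\<close>
  have conj: "of_mat (1, 0, n, 1) * S = S * of_mat (1, -n, 0, 1)" for n
    by (simp add: S_eq of_mat_mult)
  have "a = g * of_mat (1, 0, n, 1) \<longleftrightarrow> a * S = g * S * of_mat (1, -n, 0, 1)" for n
    by (metis conj mult.assoc mult_S_S)
  then have "a \<in> lcoset g Gamma_0 \<longleftrightarrow> (\<exists>n. a * S = g * S * of_mat (1, -n, 0, 1))"
    by (auto simp: lcoset_def Gamma_0_def gpow_U_S)
  also have "\<dots> \<longleftrightarrow> a * S \<in> lcoset (g * S) Gamma_inf"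
    by (auto simp: lcoset_def Gamma_inf_def gpow_T) (metis minus_minus)
  finally show ?thesis by (simp add: mem_lcoset_Gamma_inf)
qed

section \<open>Manin relations\<close>

text \<open>Congruences are taken modulo such a set; left translation enters through relations
  imposed at every group element.\<close>

definition add_subgroup :: "'a::ab_group_add set \<Rightarrow> bool" where
  "add_subgroup K \<longleftrightarrow> 0 \<in> K \<and> (\<forall>x\<in>K. \<forall>y\<in>K. x - y \<in> K)"

lemma add_subgroup_diff: "add_subgroup K \<Longrightarrow> x \<in> K \<Longrightarrow> y \<in> K \<Longrightarrow> x - y \<in> K"
  by (simp add: add_subgroup_def)

lemma add_subgroup_add:
  assumes "add_subgroup K" "x \<in> K" "y \<in> K"
  shows "x + y \<in> K"
proof -
  have "x - (0 - y) \<in> K" using assms unfolding add_subgroup_def by blast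
  then show ?thesis by simp
qed

lemma add_subgroup_sum_list:
  assumes "add_subgroup K" "\<And>x. x \<in> set xs \<Longrightarrow> f x \<in> K"
  shows "sum_list (map f xs) \<in> K"
  using assms(2)
  by (induction xs) (use assms(1) in \<open>auto simp: add_subgroup_def intro: add_subgroup_add[OF assms(1)]\<close>)

text \<open>The edge from a/c to its Farey parent b/d of smaller denominator. Right translation by a
  power of \<open>T\<close> shifts d by multiples of c, so the range of d picks one matrix per
  cusp.\<close>

definition reduced :: "psl \<Rightarrow> bool" where
  "reduced g = (case Rep_psl g of (a, b, c, d) \<Rightarrow> 0 \<le> d \<and> d < c)"

lemma reduced_of_mat:
  assumes "a * d - b * c = 1" "0 \<le> d" "d < c"
  shows "reduced (of_mat (a, b, c, d))"
  using assms by (simp add: reduced_def Rep_of_mat pnorm_def)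

lemma reducedE:
  assumes "reduced g"
  obtains a b c d where "g = of_mat (a, b, c, d)" "a * d - b * c = 1" "0 \<le> d" "d < c"
proof -
  obtain a b c d where g: "g = of_mat (a, b, c, d)" "a * d - b * c = 1" "c > 0 \<or> c = 0 \<and> d > 0"
    by (rule psl_cases)
  with assms have "0 \<le> d" "d < c" by (auto simp: reduced_def Rep_of_mat pnorm_def)
  with g that show ?thesis by blast
qed

lemma reduced_unique:
  assumes "reduced g" "reduced h" "cusp_inf g = cusp_inf h"
  shows "g = h"
proof -
  obtain a b c d where g: "g = of_mat (a, b, c, d)" "a * d - b * c = 1" "0 \<le> d" "d < c"
    using assms(1) by (rule reducedE)
  obtain n where n: "h = g * of_mat (1, n, 0, 1)" using assms(3) by (rule cusp_inf_eqE)
  have "a * (c * n + d) - (a * n + b) * c = 1" using g(2) by (simp add: algebra_simps)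
  then have "0 \<le> c * n + d" "c * n + d < c"
    using assms(2) n g by (auto simp: of_mat_mult reduced_def Rep_of_mat pnorm_def)
  with g have "c * n < c * 1" "c * (-1) < c * n" by (simp_all only: mult_1_right mult_minus1_right)
  moreover have "0 < c" using g by simp
  ultimately have "n < 1" "-1 < n" by (simp_all only: mult_less_cancel_left_pos)
  then have "n = 0" by simp
  with n show ?thesis by (simp add: one_psl_eq[symmetric])
qed

text \<open>The value 0 at \<infinity>, read as 1/0, makes \<infinity> the end of every
  descent.\<close>

definition denom :: "rat option \<Rightarrow> nat" where
  "denom x = (case x of None \<Rightarrow> 0 | Some q \<Rightarrow> nat (snd (quotient_of q)))"

lemma snd_quotient_of_frac:
  assumes "coprime a c" "c > 0"
  shows "snd (quotient_of (of_int a / of_int c)) = c"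
  using assms by (metis Fract_of_int_quotient normalize_stable quotient_of_Fract snd_conv)

lemma denom_cusp_reduced:
  assumes "reduced g"
  shows "denom (cusp_0 g) < denom (cusp_inf g)"
proof -
  obtain a b c d where g: "g = of_mat (a, b, c, d)" "a * d - b * c = 1" "0 \<le> d" "d < c"
    using assms by (rule reducedE)
  have "denom (cusp_inf g) = nat c" "denom (cusp_0 g) = nat d"
    using g coprime_of_det[OF g(2)]
    by (auto simp: denom_def cusp_inf_of_mat cusp_0_of_mat snd_quotient_of_frac)
  then show ?thesis using g by simp
qed

text \<open>The path consists of edges of the Farey tessellation. Of the two Farey parents of a cusp, the
  reducedness condition selects one; integers have \<open>\<infinity>\<close> as parent. The empty path is returned
  at \<open>\<infinity>\<close>, to which no reduced matrix belongs.\<close>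

function cusp_path :: "rat option \<Rightarrow> psl list" where
  "cusp_path x = (if \<exists>g. reduced g \<and> cusp_inf g = x
     then (SOME g. reduced g \<and> cusp_inf g = x)
       # cusp_path (cusp_0 (SOME g. reduced g \<and> cusp_inf g = x))
     else [])"
  by auto
termination
proof (relation "measure denom")
  fix x assume "\<exists>g. reduced g \<and> cusp_inf g = x"
  from someI_ex[OF this] show "(cusp_0 (SOME g. reduced g \<and> cusp_inf g = x), x) \<in> measure denom"
    using denom_cusp_reduced by fastforce
qed simp

declare cusp_path.simps [simp del]

lemma cusp_path_reduced:
  assumes "reduced g"
  shows "cusp_path (cusp_inf g) = g # cusp_path (cusp_0 g)"
proof -
  have "(SOME h. reduced h \<and> cusp_inf h = cusp_inf g) = g"
    using assms reduced_unique by (intro some_equality) auto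
  then show ?thesis using assms by (subst cusp_path.simps) auto
qed

definition path_sum :: "(psl \<Rightarrow> 'a::ab_group_add) \<Rightarrow> rat option \<Rightarrow> 'a" where
  "path_sum j x = sum_list (map j (cusp_path x))"

text \<open>Modulo \<open>K\<close>, the defect \<open>?Q\<close> changes sign when an edge is
  reversed and sums to 0 around a triangle. It vanishes on reduced edges, and a subtractive
  Euclidean descent on the lower row reaches these from every edge.\<close>

lemma manin_path_sum:
  fixes j :: "psl \<Rightarrow> 'a::ab_group_add"
  assumes K: "add_subgroup K"
    and j_S: "\<And>g. j g + j (g * S) \<in> K"
    and j_U: "\<And>g. j g + j (g * U) + j (g * U * U) \<in> K"
  shows "j g - (path_sum j (cusp_inf g) - path_sum j (cusp_0 g)) \<in> K" (is "?Q g \<in> K")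
proof -
  \<comment> \<open>Reversal swaps the two cusps, so the path parts cancel.\<close>
  have sum_Q_S: "?Q g = (j g + j (g * S)) - ?Q (g * S)" for g by (simp add: algebra_simps)
  have Q_S: "?Q g \<in> K" if "?Q (g * S) \<in> K" for g
    unfolding sum_Q_S[of g] by (rule add_subgroup_diff[OF K j_S that])
  have telescope: "x - (p - q) = (x + y + z) - ((y - (q - r)) + (z - (r - p)))"
    for x y z p q r :: 'a by (simp add: algebra_simps)
  \<comment> \<open>The three sides are rewritten with common corners \<open>cusp_inf g\<close>,
    \<open>cusp_0 g\<close>, \<open>cusp_0 (g * U)\<close>, so that their path parts
    telescope.\<close>
  have Q_gU: "?Q (g * U) = j (g * U) - (path_sum j (cusp_0 g) - path_sum j (cusp_0 (g * U)))" for g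
    by (simp only: cusp_inf_U)
  have Q_gUU: "?Q (g * U * U)
    = j (g * U * U) - (path_sum j (cusp_0 (g * U)) - path_sum j (cusp_inf g))" for g
    by (simp only: cusp_inf_U cusp_0_U_U)
  have sum_Q: "?Q g = (j g + j (g * U) + j (g * U * U)) - (?Q (g * U) + ?Q (g * U * U))" for g
    unfolding Q_gUU[of g] Q_gU[of g] by (rule telescope)
  have Q_U: "?Q g \<in> K" if "?Q (g * U) \<in> K" "?Q (g * U * U) \<in> K" for g
    unfolding sum_Q[of g] by (rule add_subgroup_diff[OF K j_U add_subgroup_add[OF K that]])
  \<comment> \<open>The fixed path of \<open>cusp_inf g\<close> begins with the edge
    \<open>g\<close> itself.\<close>
  have Q_reduced: "?Q g \<in> K" if "reduced g" for g
  proof -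
    have "path_sum j (cusp_inf g) = j g + path_sum j (cusp_0 g)"
      using cusp_path_reduced[OF that] by (simp add: path_sum_def)
    then have "?Q g = 0" by simp
    then show ?thesis using K by (simp add: add_subgroup_def)
  qed
  have Q_pos: "?Q (of_mat (a, b, c, d)) \<in> K" if "a * d - b * c = 1" "0 < c" "0 \<le> d" for a b c d
    using that
  proof (induction "nat d" arbitrary: a b c d rule: less_induct)
    case less
    show ?case
    proof (cases "d < c")
      case True
      then show ?thesis using less.prems by (intro Q_reduced reduced_of_mat) auto
    next
      case False
      \<comment> \<open>The Farey triangle on a/c and b/d with third corner (b-a)/(d-c) is used. Its
        side at a/c has the smaller lower right entry d-c; its side at b/d is reduced after
        reversal.\<close>
      let ?g = "of_mat (a, b, c, d)"
      have det: "b * (-c) - (-a) * d = 1" "a * (d - c) - (b - a) * c = 1"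
        "(b - a) * (-d) - (-b) * (d - c) = 1" "b * (d - c) - (b - a) * d = 1"
        using less.prems by (simp_all add: algebra_simps)
      have gS: "?g * S = of_mat (b, -a, d, -c)"
        using less.prems by (simp add: S_eq of_mat_mult)
      then have gSU: "?g * S * U = of_mat (a, b - a, c, d - c)"
        using det(1) by (simp add: U_eq of_mat_mult)
      then have "?g * S * U * U = of_mat (a - b, b, c - d, d)"
        using det(2) by (simp add: U_eq of_mat_mult)
      also have "\<dots> = of_mat (b - a, -b, d - c, -d)"
        using of_mat_minus[OF det(3)] by simp
      finally have "?g * S * U * U * S = of_mat (-b, a - b, -d, c - d)"
        using det(3) by (simp add: S_eq of_mat_mult)
      also have "\<dots> = of_mat (b, b - a, d, d - c)"
        using of_mat_minus[OF det(4)] by simp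
      finally have "reduced (?g * S * U * U * S)"
        using reduced_of_mat[OF det(4)] False less.prems by simp
      then have "?Q (?g * S * U * U) \<in> K" by (rule Q_S[OF Q_reduced])
      moreover have "?Q (?g * S * U) \<in> K"
        unfolding gSU using False less.prems det(2) by (intro less.hyps) auto
      ultimately show ?thesis by (rule Q_S[OF Q_U, rotated])
    qed
  qed
  obtain a b c d where g: "g = of_mat (a, b, c, d)" "a * d - b * c = 1" "c > 0 \<or> c = 0 \<and> d > 0"
    by (rule psl_cases)
  show ?thesis
  proof (cases "c > 0 \<and> d \<ge> 0")
    case True
    then show ?thesis using Q_pos g by simp
  next
    \<comment> \<open>Here c = 0 or d < 0. Multiplication by \<open>S\<close> turns the lower row
      into (d, -c), which is of the form treated in \<open>Q_pos\<close> after a sign change if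
      needed.\<close>
    case neg: False
    show ?thesis
    proof (rule Q_S)
      have det: "b * (-c) - (-a) * d = 1" "(-b) * c - a * (-d) = 1"
        using g(2) by (simp_all add: algebra_simps)
      have gS: "g * S = of_mat (b, -a, d, -c)" using g by (simp add: S_eq of_mat_mult)
      show "?Q (g * S) \<in> K"
      proof (cases "c = 0")
        case True
        then show ?thesis unfolding gS using g det by (intro Q_pos) auto
      next
        case False
        have "g * S = of_mat (-b, a, -d, c)" using gS of_mat_minus[OF det(1)] by simp
        then show ?thesis using False neg g det(2) by (simp only:) (intro Q_pos, auto)
      qed
    qed
  qed
qed

section \<open>Linear extension\<close>

text \<open>On finitely supported \<open>f\<close>, the linear functional that takes the value
  \<open>\<phi> x\<close> at the basis element \<open>x\<close>.\<close>

definition lin :: "('a \<Rightarrow> int) \<Rightarrow> ('a \<Rightarrow> int) \<Rightarrow> int" where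
  "lin \<phi> f = (\<Sum>x | f x \<noteq> 0. f x * \<phi> x)"

text \<open>The linear map sending the basis element \<open>x\<close> to \<open>h x\<close>, given
  by coordinates so that its laws follow from those of \<open>lin\<close>.\<close>

definition lin_fun :: "('a \<Rightarrow> 'b \<Rightarrow> int) \<Rightarrow> ('a \<Rightarrow> int) \<Rightarrow> 'b \<Rightarrow> int" where
  "lin_fun h f y = lin (\<lambda>x. h x y) f"

lemma lin_superset:
  assumes "finite A" "\<And>x. f x \<noteq> 0 \<Longrightarrow> x \<in> A"
  shows "lin \<phi> f = (\<Sum>x\<in>A. f x * \<phi> x)"
  unfolding lin_def using assms by (intro sum.mono_neutral_left) auto

lemma fin_supp_delta [simp]: "fin_supp (delta x)"
  by (simp add: fin_supp_def delta_def)

lemma fin_supp_0 [simp]: "fin_supp 0"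
  by (simp add: fin_supp_def)

lemma fin_supp_add [simp]: "fin_supp f \<Longrightarrow> fin_supp g \<Longrightarrow> fin_supp (f + g)"
  unfolding fin_supp_def by (rule finite_subset[of _ "{x. f x \<noteq> 0} \<union> {x. g x \<noteq> 0}"]) auto

lemma fin_supp_diff [simp]: "fin_supp f \<Longrightarrow> fin_supp g \<Longrightarrow> fin_supp (f - g)"
  unfolding fin_supp_def by (rule finite_subset[of _ "{x. f x \<noteq> 0} \<union> {x. g x \<noteq> 0}"]) auto

lemma fin_supp_lin_fun [simp]:
  assumes "fin_supp f" "\<And>x. fin_supp (h x)"
  shows "fin_supp (lin_fun h f)"
proof -
  have "{y. lin_fun h f y \<noteq> 0} \<subseteq> (\<Union>x\<in>{x. f x \<noteq> 0}. {y. h x y \<noteq> 0})"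
  proof
    fix y assume "y \<in> {y. lin_fun h f y \<noteq> 0}"
    then have "(\<Sum>x | f x \<noteq> 0. f x * h x y) \<noteq> 0" by (simp add: lin_fun_def lin_def)
    then obtain x where "x \<in> {x. f x \<noteq> 0}" "f x * h x y \<noteq> 0" using sum.not_neutral_contains_not_neutral by blast
    then show "y \<in> (\<Union>x\<in>{x. f x \<noteq> 0}. {y. h x y \<noteq> 0})" by auto
  qed
  moreover have "finite (\<Union>x\<in>{x. f x \<noteq> 0}. {y. h x y \<noteq> 0})"
    using assms by (simp add: fin_supp_def)
  ultimately show ?thesis unfolding fin_supp_def by (rule finite_subset)
qed

lemma lin_add:
  assumes "fin_supp f" "fin_supp g"
  shows "lin \<phi> (f + g) = lin \<phi> f + lin \<phi> g"
proof -
  let ?A = "{x. f x \<noteq> 0} \<union> {x. g x \<noteq> 0}"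
  have fin: "finite ?A" using assms by (simp add: fin_supp_def)
  have "lin \<phi> f = (\<Sum>x\<in>?A. f x * \<phi> x)" "lin \<phi> g = (\<Sum>x\<in>?A. g x * \<phi> x)"
    "lin \<phi> (f + g) = (\<Sum>x\<in>?A. (f + g) x * \<phi> x)"
    by (rule lin_superset[OF fin]; auto)+
  then show ?thesis by (simp add: distrib_right sum.distrib)
qed

lemma lin_diff:
  assumes "fin_supp f" "fin_supp g"
  shows "lin \<phi> (f - g) = lin \<phi> f - lin \<phi> g"
  using lin_add[of "f - g" g \<phi>] assms by simp

lemma lin_0 [simp]: "lin \<phi> 0 = 0"
  by (simp add: lin_def)

lemma lin_0_left [simp]: "lin (\<lambda>x. 0) f = 0"
  by (simp add: lin_def)

lemma lin_diff_left: "lin (\<lambda>x. \<phi> x - \<psi> x) f = lin \<phi> f - lin \<psi> f"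
  by (simp add: lin_def right_diff_distrib sum_subtractf)

lemma lin_delta [simp]: "lin \<phi> (delta x) = \<phi> x"
proof -
  have "lin \<phi> (delta x) = (\<Sum>y\<in>{x}. delta x y * \<phi> y)"
    by (rule lin_superset) (auto simp: delta_def split: if_splits)
  then show ?thesis by (simp add: delta_def)
qed

text \<open>Interchange of two finite sums. This is how vanishing of a boundary passes to every
  linear expression in that boundary.\<close>

lemma lin_lin_fun:
  assumes "fin_supp f" "\<And>x. fin_supp (h x)"
  shows "lin \<phi> (lin_fun h f) = lin (\<lambda>x. lin \<phi> (h x)) f"
proof -
  define A where "A = {x. f x \<noteq> 0}"
  define B where "B = (\<Union>x\<in>A. {y. h x y \<noteq> 0})"
  have fin: "finite A" "finite B" using assms by (auto simp: A_def B_def fin_supp_def)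
  have B: "y \<in> B" if "lin_fun h f y \<noteq> 0" for y
  proof (rule ccontr)
    assume "y \<notin> B"
    then have "lin_fun h f y = 0" unfolding lin_fun_def lin_def by (intro sum.neutral) (auto simp: B_def A_def)
    with that show False by simp
  qed
  have "lin \<phi> (lin_fun h f) = (\<Sum>y\<in>B. (\<Sum>x\<in>A. f x * h x y) * \<phi> y)"
    by (subst lin_superset[OF fin(2) B]) (simp_all add: lin_fun_def lin_def A_def)
  also have "\<dots> = (\<Sum>x\<in>A. \<Sum>y\<in>B. f x * (h x y * \<phi> y))"
    by (simp add: sum_distrib_right mult.assoc) (rule sum.swap)
  also have "\<dots> = (\<Sum>x\<in>A. f x * lin \<phi> (h x))"
  proof (rule sum.cong)
    fix x assume "x \<in> A"
    then have "lin \<phi> (h x) = (\<Sum>y\<in>B. h x y * \<phi> y)"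
      by (intro lin_superset fin) (auto simp: B_def)
    then show "(\<Sum>y\<in>B. f x * (h x y * \<phi> y)) = f x * lin \<phi> (h x)" by (simp add: sum_distrib_left)
  qed simp
  finally show ?thesis by (simp add: lin_def A_def)
qed

lemma lin_fun_add: "fin_supp f \<Longrightarrow> fin_supp g \<Longrightarrow> lin_fun h (f + g) = lin_fun h f + lin_fun h g"
  by (rule ext) (simp add: lin_fun_def lin_add)

lemma lin_fun_diff: "fin_supp f \<Longrightarrow> fin_supp g \<Longrightarrow> lin_fun h (f - g) = lin_fun h f - lin_fun h g"
  by (rule ext) (simp add: lin_fun_def lin_diff)

lemma lin_fun_diff_left: "lin_fun (\<lambda>x. h x - k x) f = lin_fun h f - lin_fun k f"
  by (rule ext) (simp add: lin_fun_def lin_diff_left)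

lemma lin_fun_0 [simp]: "lin_fun h 0 = 0"
  by (rule ext) (simp add: lin_fun_def)

lemma lin_fun_delta [simp]: "lin_fun h (delta x) = h x"
  by (rule ext) (simp add: lin_fun_def)

lemma lin_fun_delta_id: "lin_fun delta f = f" if "fin_supp f"
proof
  fix y
  have "lin (\<lambda>x. delta x y) f = (\<Sum>x\<in>{x. f x \<noteq> 0} \<union> {y}. f x * delta x y)"
    using that by (intro lin_superset) (auto simp: fin_supp_def)
  also have "\<dots> = f y"
    using that by (simp add: fin_supp_def delta_def if_distrib[of "(*) _"] cong: if_cong)
  finally show "lin_fun delta f y = f y" by (simp add: lin_fun_def)
qed

lemma add_subgroup_zmult:
  fixes h :: "'b \<Rightarrow> int"
  assumes K: "add_subgroup K" and h: "h \<in> K"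
  shows "(\<lambda>y. n * h y) \<in> K"
proof (induction n rule: int_induct[of _ 0])
  case base
  then show ?case using K by (simp add: add_subgroup_def zero_fun_def)
next
  case (step1 i)
  have "(\<lambda>y. (i + 1) * h y) = (\<lambda>y. i * h y) + h" by (auto simp: algebra_simps)
  then show ?case using add_subgroup_add[OF K step1(2) h] by simp
next
  case (step2 i)
  have "(\<lambda>y. (i - 1) * h y) = (\<lambda>y. i * h y) - h" by (auto simp: algebra_simps)
  then show ?case using add_subgroup_diff[OF K step2(2) h] by simp
qed

text \<open>Extends a congruence checked on basis elements to all their integer
  combinations.\<close>

lemma add_subgroup_lin_fun:
  assumes K: "add_subgroup K" and h: "\<And>x. h x \<in> K"
  shows "lin_fun h f \<in> K"
proof -
  have "(\<lambda>y. \<Sum>x\<in>A. f x * h x y) \<in> K" if "finite A" for A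
    using that
  proof (induction A)
    case empty
    then show ?case using K by (simp add: add_subgroup_def zero_fun_def)
  next
    case (insert a A)
    have "(\<lambda>y. \<Sum>x\<in>insert a A. f x * h x y) = (\<lambda>y. f a * h a y) + (\<lambda>y. \<Sum>x\<in>A. f x * h x y)"
      using insert.hyps by auto
    then show ?case using add_subgroup_add[OF K add_subgroup_zmult[OF K h] insert.IH] by metis
  qed
  \<comment> \<open>Covers infinite support, where the sum is 0 by convention.\<close>
  moreover have "(\<lambda>y. 0) \<in> K" using K by (simp add: add_subgroup_def zero_fun_def)
  moreover have "lin_fun h f = (\<lambda>y. \<Sum>x | f x \<noteq> 0. f x * h x y)"
    by (rule ext) (simp add: lin_fun_def lin_def)
  ultimately show ?thesis
    by (cases "finite {x. f x \<noteq> 0}") simp_all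
qed

text \<open>The constraint \<open>m x y = z\<close> becomes the factor
  \<open>delta (m x y) z\<close>, which exhibits the product as a bilinear extension of
  \<open>m\<close>.\<close>

lemma conv_eq_lin_fun:
  assumes "fin_supp f" "fin_supp h"
  shows "conv m f h = lin_fun (\<lambda>x. lin_fun (\<lambda>y. delta (m x y)) h) f"
proof
  fix z
  let ?A = "{x. f x \<noteq> 0}" and ?B = "{y. h y \<noteq> 0}"
  have "conv m f h z = (\<Sum>(x, y)\<in>?A \<times> ?B. f x * (h y * delta (m x y) z))"
    unfolding conv_def using assms
    by (intro sum.mono_neutral_cong_left) (auto simp: fin_supp_def delta_def split: if_splits)
  also have "\<dots> = (\<Sum>x\<in>?A. f x * (\<Sum>y\<in>?B. h y * delta (m x y) z))"
    by (simp add: sum.cartesian_product[symmetric] sum_distrib_left)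
  finally show "conv m f h z = lin_fun (\<lambda>x. lin_fun (\<lambda>y. delta (m x y)) h) f z"
    by (simp add: lin_fun_def lin_def)
qed

section \<open>The four generators\<close>

lemma pmul2_Pair [simp]: "pmul2 (a, b) (c, d) = (a * c, b * d)"
  by (simp add: pmul2_def)

lemma tens_delta: "tens (delta a) (delta b) = delta (a, b)"
  by (auto simp: tens_def delta_def fun_eq_iff)

lemma tens_add_left: "tens (a + a') b = tens a b + tens a' b"
  by (auto simp: tens_def algebra_simps)

lemma tens_add_right: "tens a (b + b') = tens a b + tens a b'"
  by (auto simp: tens_def algebra_simps)

lemmas tens_simps = tens_delta tens_add_left tens_add_right

lemma mul2_eq_lin_fun:
  "fin_supp f \<Longrightarrow> fin_supp h \<Longrightarrow>
    mul2 f h = lin_fun (\<lambda>x. lin_fun (\<lambda>y. delta (pmul2 x y)) h) f"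
  by (simp add: mul2_def conv_eq_lin_fun)

lemma mul2_delta: "mul2 (delta x) (delta y) = delta (pmul2 x y)"
  by (simp add: mul2_eq_lin_fun)

lemma mul2_add_left:
  "fin_supp f \<Longrightarrow> fin_supp g \<Longrightarrow> fin_supp h \<Longrightarrow> mul2 (f + g) h = mul2 f h + mul2 g h"
  by (simp add: mul2_eq_lin_fun lin_fun_add)

lemma mul2_delta_add:
  "fin_supp g \<Longrightarrow> fin_supp h \<Longrightarrow> mul2 (delta x) (g + h) = mul2 (delta x) g + mul2 (delta x) h"
  by (simp only: mul2_eq_lin_fun fin_supp_delta fin_supp_add lin_fun_delta) (simp only: lin_fun_add)

lemma gen1_eq: "gen1 = delta (1, 1) + delta (1, S) + delta (S, 1) + delta (S, S)"
  by (simp add: gen1_def tens_simps add_ac)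

lemma gen2_eq: "gen2 = delta (S, S) + delta (S, U * S) + delta (U * S, U * S) + delta (1, U)
    - delta (U * U, U * U)"
  by (simp add: gen2_def tens_simps)

lemma gen3_eq: "gen3 = delta (1, 1) + delta (U, 1) + delta (U * U, 1)
    + delta (S, S) + delta (U * S, S) + delta (U * U * S, S)"
  by (simp add: gen3_def tens_simps mul2_add_left mul2_delta_add mul2_delta add_ac)

lemma gen4_eq: "gen4 = delta (1, 1) + delta (1, U) + delta (1, U * U)
    + delta (S, S) + delta (S, U * S) + delta (S, U * U * S)"
  by (simp add: gen4_def tens_simps mul2_add_left mul2_delta_add mul2_delta add_ac)

lemma fin_supp_gen [simp]: "fin_supp gen1" "fin_supp gen2" "fin_supp gen3" "fin_supp gen4"
  by (simp_all add: gen1_eq gen2_eq gen3_eq gen4_eq)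

text \<open>Left multiplication by one group element; the translates of the four generators span
  \<open>I2\<close> additively.\<close>

definition translate :: "psl \<times> psl \<Rightarrow> (psl \<times> psl \<Rightarrow> int) \<Rightarrow> psl \<times> psl \<Rightarrow> int" where
  "translate x = lin_fun (\<lambda>y. delta (pmul2 x y))"

lemma translate_delta [simp]: "translate (a, b) (delta (c, d)) = delta (a * c, b * d)"
  by (simp add: translate_def)

lemma translate_add:
  "fin_supp f \<Longrightarrow> fin_supp g \<Longrightarrow> translate x (f + g) = translate x f + translate x g"
  by (simp add: translate_def lin_fun_add)

lemma translate_diff:
  "fin_supp f \<Longrightarrow> fin_supp g \<Longrightarrow> translate x (f - g) = translate x f - translate x g"
  by (simp add: translate_def lin_fun_diff)

lemma fin_supp_translate [simp]: "fin_supp f \<Longrightarrow> fin_supp (translate x f)"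
  by (simp add: translate_def)

lemma mul2_eq_translate: "r \<in> ZG2 \<Longrightarrow> fin_supp h \<Longrightarrow> mul2 r h = lin_fun (\<lambda>x. translate x h) r"
  by (simp add: mul2_eq_lin_fun translate_def ZG2_def)

definition gen_comb :: "(psl \<times> psl \<Rightarrow> int) \<Rightarrow> (psl \<times> psl \<Rightarrow> int) \<Rightarrow> (psl \<times> psl \<Rightarrow> int)
    \<Rightarrow> (psl \<times> psl \<Rightarrow> int) \<Rightarrow> psl \<times> psl \<Rightarrow> int" where
  "gen_comb r1 r2 r3 r4 = lin_fun (\<lambda>x. translate x gen1) r1 + lin_fun (\<lambda>x. translate x gen2) r2
    + lin_fun (\<lambda>x. translate x gen3) r3 + lin_fun (\<lambda>x. translate x gen4) r4"

lemma gen_comb_eq_mul2: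
  assumes "r1 \<in> ZG2" "r2 \<in> ZG2" "r3 \<in> ZG2" "r4 \<in> ZG2"
  shows "gen_comb r1 r2 r3 r4 = mul2 r1 gen1 + mul2 r2 gen2 + mul2 r3 gen3 + mul2 r4 gen4"
  using assms by (simp add: gen_comb_def mul2_eq_translate)

lemma gen_comb_in_I2:
  assumes "r1 \<in> ZG2" "r2 \<in> ZG2" "r3 \<in> ZG2" "r4 \<in> ZG2"
  shows "gen_comb r1 r2 r3 r4 \<in> I2"
  unfolding I2_def using assms gen_comb_eq_mul2[OF assms] by blast

lemma I2E:
  assumes "f \<in> I2"
  obtains r1 r2 r3 r4 where "r1 \<in> ZG2" "r2 \<in> ZG2" "r3 \<in> ZG2" "r4 \<in> ZG2" "f = gen_comb r1 r2 r3 r4"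
proof -
  obtain r1 r2 r3 r4 where r: "r1 \<in> ZG2" "r2 \<in> ZG2" "r3 \<in> ZG2" "r4 \<in> ZG2"
    and f: "f = mul2 r1 gen1 + mul2 r2 gen2 + mul2 r3 gen3 + mul2 r4 gen4"
    using assms unfolding I2_def by (elim CollectE exE conjE)
  show ?thesis by (rule that[OF r]) (simp only: f gen_comb_eq_mul2[OF r])
qed

section \<open>The left ideal as the additive span of translated generators\<close>

lemma zero_in_ZG2: "0 \<in> ZG2"
  by (simp add: ZG2_def)

lemma delta_in_ZG2: "delta x \<in> ZG2"
  by (simp add: ZG2_def)

lemma add_subgroup_I2: "add_subgroup I2"
  unfolding add_subgroup_def
proof (intro conjI ballI)
  show "0 \<in> I2"
    using gen_comb_in_I2[OF zero_in_ZG2 zero_in_ZG2 zero_in_ZG2 zero_in_ZG2] by (simp add: gen_comb_def)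
next
  fix f g assume "f \<in> I2" "g \<in> I2"
  obtain r1 r2 r3 r4 where r: "r1 \<in> ZG2" "r2 \<in> ZG2" "r3 \<in> ZG2" "r4 \<in> ZG2"
    and f: "f = gen_comb r1 r2 r3 r4" using \<open>f \<in> I2\<close> by (rule I2E)
  obtain s1 s2 s3 s4 where s: "s1 \<in> ZG2" "s2 \<in> ZG2" "s3 \<in> ZG2" "s4 \<in> ZG2"
    and g: "g = gen_comb s1 s2 s3 s4" using \<open>g \<in> I2\<close> by (rule I2E)
  have "f - g = gen_comb (r1 - s1) (r2 - s2) (r3 - s3) (r4 - s4)"
    using r s by (simp only: f g gen_comb_def lin_fun_diff ZG2_def mem_Collect_eq add_diff_add)
  also have "\<dots> \<in> I2"
    using r s by (intro gen_comb_in_I2) (simp_all add: ZG2_def)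
  finally show "f - g \<in> I2" .
qed

lemma translate_gen_in_I2:
  "translate x gen1 \<in> I2" "translate x gen2 \<in> I2" "translate x gen3 \<in> I2" "translate x gen4 \<in> I2"
  using gen_comb_in_I2[OF delta_in_ZG2[of x] zero_in_ZG2 zero_in_ZG2 zero_in_ZG2]
    gen_comb_in_I2[OF zero_in_ZG2 delta_in_ZG2[of x] zero_in_ZG2 zero_in_ZG2]
    gen_comb_in_I2[OF zero_in_ZG2 zero_in_ZG2 delta_in_ZG2[of x] zero_in_ZG2]
    gen_comb_in_I2[OF zero_in_ZG2 zero_in_ZG2 zero_in_ZG2 delta_in_ZG2[of x]]
  by (simp_all add: gen_comb_def)

lemma lin_eq_0_on_I2:
  assumes f: "f \<in> I2"
    and \<phi>: "\<And>x. lin \<phi> (translate x gen1) = 0" "\<And>x. lin \<phi> (translate x gen2) = 0"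
      "\<And>x. lin \<phi> (translate x gen3) = 0" "\<And>x. lin \<phi> (translate x gen4) = 0"
  shows "lin \<phi> f = 0"
proof -
  obtain r1 r2 r3 r4 where r: "r1 \<in> ZG2" "r2 \<in> ZG2" "r3 \<in> ZG2" "r4 \<in> ZG2"
    and f: "f = gen_comb r1 r2 r3 r4" using f by (rule I2E)
  show ?thesis unfolding f gen_comb_def using r by (simp add: lin_add lin_lin_fun \<phi> ZG2_def)
qed

lemma fin_supp_I2: "f \<in> I2 \<Longrightarrow> fin_supp f"
  by (erule I2E) (simp add: gen_comb_def ZG2_def)

lemma translate_gen1: "translate (a, b) gen1
    = delta (a, b) + delta (a, b * S) + delta (a * S, b) + delta (a * S, b * S)"
  by (simp add: gen1_eq translate_add)

lemma translate_gen2: "translate (a, b) gen2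
    = delta (a * S, b * S) + delta (a * S, b * U * S) + delta (a * U * S, b * U * S)
      + delta (a, b * U) - delta (a * U * U, b * U * U)"
  by (simp add: gen2_eq translate_add translate_diff mult.assoc)

lemma translate_gen3: "translate (a, b) gen3
    = delta (a, b) + delta (a * U, b) + delta (a * U * U, b)
      + delta (a * S, b * S) + delta (a * U * S, b * S) + delta (a * U * U * S, b * S)"
  by (simp add: gen3_eq translate_add mult.assoc)

lemma translate_gen4: "translate (a, b) gen4
    = delta (a, b) + delta (a, b * U) + delta (a, b * U * U)
      + delta (a * S, b * S) + delta (a * S, b * U * S) + delta (a * S, b * U * U * S)"
  by (simp add: gen4_eq translate_add mult.assoc)

lemmas translate_gens = translate_gen1 translate_gen2 translate_gen3 translate_gen4

section \<open>The ideals as kernels of linear functionals\<close>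

text \<open>Cosets of \<open>Gamma_inf\<close> correspond to cusps \<open>cusp_inf g\<close>, so
  each coset and each coordinate \<open>p\<close> contribute one linear functional.\<close>

lemma I_H_iff: "f \<in> I_H \<longleftrightarrow> fin_supp f \<and>
    (\<forall>g p. lin (\<lambda>(a, b). if cusp_inf b = cusp_inf g then bdry a p else 0) f = 0)"
proof -
  have "(\<Sum>(a, b) \<in> {(a, b). f (a, b) \<noteq> 0 \<and> b \<in> lcoset g Gamma_inf}. f (a, b) * bdry a p)
      = lin (\<lambda>(a, b). if cusp_inf b = cusp_inf g then bdry a p else 0) f" if "fin_supp f" for g p
    unfolding lin_def using that
    by (intro sum.mono_neutral_cong_left) (auto simp: fin_supp_def mem_lcoset_Gamma_inf split: if_splits)
  then show ?thesis by (auto simp: I_H_def ZG2_def fun_eq_iff)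
qed

lemma I_V_iff: "f \<in> I_V \<longleftrightarrow> fin_supp f \<and>
    (\<forall>g p. lin (\<lambda>(a, b). if cusp_0 a = cusp_0 g then bdry b p else 0) f = 0)"
proof -
  have "(\<Sum>(a, b) \<in> {(a, b). f (a, b) \<noteq> 0 \<and> a \<in> lcoset g Gamma_0}. f (a, b) * bdry b p)
      = lin (\<lambda>(a, b). if cusp_0 a = cusp_0 g then bdry b p else 0) f" if "fin_supp f" for g p
    unfolding lin_def using that
    by (intro sum.mono_neutral_cong_left) (auto simp: fin_supp_def mem_lcoset_Gamma_0 split: if_splits)
  then show ?thesis by (auto simp: I_V_def ZG2_def fun_eq_iff)
qed

lemma I_D_iff: "f \<in> I_D \<longleftrightarrow> fin_supp f \<and>
    (\<forall>g p. lin (\<lambda>(a, b). if b = g * a then bdry a p else 0) f = 0)"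
proof -
  have "(\<Sum>(a, b) \<in> {(a, b). f (a, b) \<noteq> 0 \<and> b * inverse a = g}. f (a, b) * bdry a p)
      = lin (\<lambda>(a, b). if b = g * a then bdry a p else 0) f" if "fin_supp f" for g p
    unfolding lin_def using that
    by (intro sum.mono_neutral_cong_left) (auto simp: fin_supp_def psl_mult_inverse_eq_iff split: if_splits)
  then show ?thesis by (auto simp: I_D_def ZG2_def fun_eq_iff)
qed

text \<open>In each translated generator, the first components sharing a cusp
  \<open>cusp_inf b\<close> either cancel as an edge and its reverse or close up a triangle.\<close>

lemma I2_subset_I_H: "I2 \<subseteq> I_H"
proof
  fix f assume f: "f \<in> I2"
  have "lin (\<lambda>(a, b). if cusp_inf b = cusp_inf g then bdry a p else 0) f = 0" for g p
    by (rule lin_eq_0_on_I2[OF f];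
        simp only: split_paired_all translate_gens;
        simp add: lin_add lin_diff bdry_eq)
  then show "f \<in> I_H" using f by (simp add: I_H_iff fin_supp_I2)
qed

lemma I2_subset_I_V: "I2 \<subseteq> I_V"
proof
  fix f assume f: "f \<in> I2"
  have "lin (\<lambda>(a, b). if cusp_0 a = cusp_0 g then bdry b p else 0) f = 0" for g p
    by (rule lin_eq_0_on_I2[OF f];
        simp only: split_paired_all translate_gens;
        simp add: lin_add lin_diff bdry_eq)
  then show "f \<in> I_V" using f by (simp add: I_V_iff fin_supp_I2)
qed

lemma I2_subset_I_D: "I2 \<subseteq> I_D"
proof
  fix f assume f: "f \<in> I2"
  have cancel: "b * x = g * (a * x) \<longleftrightarrow> b = g * a" for a b g x :: psl
    by (metis mult.assoc psl_mult_right_cancel)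
  \<comment> \<open>Since \<open>S\<close> is an involution, (a, b S) and (a S, b) lie on the same
    diagonal; the first generator needs this.\<close>
  have swap_S: "b * S = g * a \<longleftrightarrow> b = g * (a * S)" for a b g
    using cancel[of "b * S" S g a] by (simp add: mult.assoc S_S)
  have "lin (\<lambda>(a, b). if b = g * a then bdry a p else 0) f = 0" for g p
    by (rule lin_eq_0_on_I2[OF f];
        simp only: split_paired_all translate_gens;
        simp add: lin_add lin_diff bdry_eq cancel swap_S)
  then show "f \<in> I_D" using f by (simp add: I_D_iff fin_supp_I2)
qed

section \<open>Decomposition into squares\<close>

text \<open>The left translate of \<sigma> by \<open>x\<close>.\<close>

definition square :: "psl \<times> psl \<Rightarrow> psl \<times> psl \<Rightarrow> int" where
  "square x = delta x + delta (fst x * S, snd x * S)"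

lemma fin_supp_square [simp]: "fin_supp (square x)"
  by (simp add: square_def)

text \<open>This and the next three identities say that \<open>square\<close> satisfies Manin's
  relations in each variable modulo \<open>I2\<close>.\<close>

lemma square_add_S_left: "square (a, b) + square (a * S, b) = translate (a, b) gen1"
  by (simp add: square_def translate_gen1 add_ac)

lemma square_add_S_right: "square (a, b) + square (a, b * S) = translate (a, b) gen1"
  by (simp add: square_def translate_gen1 add_ac)

lemma square_add_U_left:
  "square (a, b) + square (a * U, b) + square (a * U * U, b) = translate (a, b) gen3"
  by (simp add: square_def translate_gen3 add_ac)

lemma square_add_U_right:
  "square (a, b) + square (a, b * U) + square (a, b * U * U) = translate (a, b) gen4"
  by (simp add: square_def translate_gen4 add_ac)

text \<open>Expresses the translate of \<tau> through squares modulo \<open>I2\<close>.\<close>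

lemma square_diff_gen2:
  "square (a, b) + square (a * U, b * U) + square (a, b * U) - translate (a, b) gen2
    = delta (a, b) + delta (a * U, b * U) + delta (a * U * U, b * U * U)"
  by (simp add: square_def translate_gen2 diff_eq_eq add_ac)

section \<open>Path sums and the span of the squares modulo \<open>I2\<close>\<close>

lemma sum_list_apply: "sum_list (map f xs) z = sum_list (map (\<lambda>x. f x z) xs)"
  by (induction xs) simp_all

lemma path_sum_apply: "path_sum j x z = path_sum (\<lambda>g. j g z) x"
  by (simp add: path_sum_def sum_list_apply)

lemma path_sum_add: "path_sum (\<lambda>g. j g + k g) x = path_sum j x + path_sum k x"
  by (simp add: path_sum_def sum_list_addf)

lemma add_subgroup_path_sum:
  "add_subgroup K \<Longrightarrow> (\<And>g. j g \<in> K) \<Longrightarrow> path_sum j x \<in> K"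
  by (simp add: path_sum_def add_subgroup_sum_list)

lemma bdry_eq_delta: "bdry g = delta (cusp_inf g) - delta (cusp_0 g)"
  by (simp add: fun_eq_iff bdry_eq pt_def delta_def)

definition square_span :: "(psl \<times> psl \<Rightarrow> int) set" where
  "square_span = {h. \<exists>a. fin_supp a \<and> h - lin_fun square a \<in> I2}"

lemma square_spanI: "fin_supp a \<Longrightarrow> h - lin_fun square a \<in> I2 \<Longrightarrow> h \<in> square_span"
  unfolding square_span_def by blast

lemma add_subgroup_square_span: "add_subgroup square_span"
  unfolding add_subgroup_def
proof (intro conjI ballI)
  show "0 \<in> square_span"
    by (rule square_spanI[of 0]) (use add_subgroup_I2 in \<open>simp_all add: add_subgroup_def\<close>)
next
  fix f g assume "f \<in> square_span" "g \<in> square_span"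
  then obtain a b where a: "fin_supp a" "f - lin_fun square a \<in> I2"
    and b: "fin_supp b" "g - lin_fun square b \<in> I2"
    unfolding square_span_def by blast
  have "(f - g) - lin_fun square (a - b) = (f - lin_fun square a) - (g - lin_fun square b)"
    unfolding lin_fun_diff[OF a(1) b(1)] by (simp add: algebra_simps del: minus_apply)
  also have "\<dots> \<in> I2" by (rule add_subgroup_diff[OF add_subgroup_I2 a(2) b(2)])
  finally show "f - g \<in> square_span" using a b by (intro square_spanI[of "a - b"]) simp_all
qed

lemma square_in_square_span: "square x \<in> square_span"
  by (rule square_spanI[of "delta x"]) (use add_subgroup_I2 in \<open>simp_all add: add_subgroup_def\<close>)

lemma I2_subset_square_span: "I2 \<subseteq> square_span"
  by (auto intro: square_spanI[of 0])

text \<open>On the diagonal with quotient \<open>g\<close>, Manin's relations for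
  \<open>delta (a, g * a)\<close> are translates of \<sigma> and \<tau>, both in the span. Each pair
  may thus be replaced by a difference of paths, and these differences sum to 0 because the boundary
  on every diagonal vanishes.\<close>

lemma I_D_subset_square_span: "I_D \<subseteq> square_span"
proof
  fix f assume f: "f \<in> I_D"
  then have fin: "fin_supp f" by (simp add: I_D_iff)
  note K = add_subgroup_square_span
  define P where "P g = path_sum (\<lambda>a. delta (a, g * a))" for g
  define Q where "Q = (\<lambda>(a, b). P (b * inverse a) (cusp_inf a) - P (b * inverse a) (cusp_0 a))"
  have "delta (a, g * a) - (P g (cusp_inf a) - P g (cusp_0 a)) \<in> square_span" for a g
    unfolding P_def
  proof (rule manin_path_sum[OF K])
    fix a
    show "delta (a, g * a) + delta (a * S, g * (a * S)) \<in> square_span"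
      using square_in_square_span[of "(a, g * a)"] by (simp add: square_def mult.assoc)
    have "square (a, g * a) + square (a * U, g * a * U) + square (a, g * a * U)
        - translate (a, g * a) gen2 \<in> square_span"
      using I2_subset_square_span translate_gen_in_I2(2)
      by (intro add_subgroup_diff[OF K] add_subgroup_add[OF K] square_in_square_span) blast
    then show "delta (a, g * a) + delta (a * U, g * (a * U)) + delta (a * U * U, g * (a * U * U))
        \<in> square_span"
      unfolding square_diff_gen2 by (simp add: mult.assoc)
  qed
  then have "delta (a, b) - (P (b * inverse a) (cusp_inf a) - P (b * inverse a) (cusp_0 a))
      \<in> square_span" for a b
    by (metis psl_mult_inverse_eq_iff)
  then have "delta x - Q x \<in> square_span" for x
    by (cases x) (simp add: Q_def)
  then have "lin_fun (\<lambda>x. delta x - Q x) f \<in> square_span"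
    by (rule add_subgroup_lin_fun[OF K])
  moreover have "lin_fun Q f = 0"
  proof
    fix z :: "psl \<times> psl"
    obtain z1 z2 where z: "z = (z1, z2)" by (cases z)
    define g where "g = z2 * inverse z1"
    \<comment> \<open>For the coordinate \<open>z\<close>, only the diagonal \<open>g\<close>
      through \<open>z\<close> matters; there \<open>Q\<close> is the linear extension of
      \<open>c\<close> applied to the boundary \<open>D\<close>.\<close>
    define c where "c x = path_sum (\<lambda>a. delta a z1) x" for x
    define D where "D = (\<lambda>(a, b). if b = g * a then bdry a else 0)"
    have g: "b * inverse a = g \<longleftrightarrow> b = g * a" for a b by (rule psl_mult_inverse_eq_iff)
    have z2: "z2 = k * z1 \<longleftrightarrow> k = g" for k
      using psl_mult_inverse_eq_iff[of z2 z1 k] by (auto simp: g_def)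
    have "P k x z = (if k = g then c x else 0)" for k x
    proof -
      have "delta (a, k * a) z = (if k = g then delta a z1 else 0)" for a
        using z2[of k] by (auto simp: z delta_def)
      then show ?thesis by (simp add: P_def path_sum_apply c_def) (simp add: path_sum_def)
    qed
    then have "Q x z = lin c (D x)" for x
      by (cases x) (simp add: Q_def D_def g bdry_eq_delta lin_diff)
    then have "lin_fun Q f z = lin (\<lambda>x. lin c (D x)) f"
      by (simp add: lin_fun_def)
    also have "\<dots> = lin c (lin_fun D f)"
      using fin by (subst lin_lin_fun) (auto simp: D_def bdry_eq_delta)
    also have "lin_fun D f = 0"
    proof
      fix p
      have "D x p = (case x of (a, b) \<Rightarrow> if b = g * a then bdry a p else 0)" for x
        by (simp add: D_def split: prod.split)
      then show "lin_fun D f p = 0 p"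
        using f by (simp add: lin_fun_def I_D_iff)
    qed
    finally show "lin_fun Q f z = 0 z" by (simp add: lin_def)
  qed
  ultimately show "f \<in> square_span"
    using fin by (simp add: lin_fun_diff_left lin_fun_delta_id)
qed

text \<open>The two triangles of a square carry opposite edges \<open>\<partial> a\<close> at the
  cusps \<open>cusp_inf b\<close> and \<open>cusp_0 b\<close>, so a functional defining
  \<open>I_H\<close> reads off \<open>\<partial> \<otimes> \<partial>\<close>.\<close>

lemma lin_bdry_bdry_eq_0:
  assumes "fin_supp c" "lin_fun square c \<in> I_H"
  shows "lin (\<lambda>(a, b). bdry a p * bdry b q) c = 0"
\<comment> \<open>The functionals of \<open>I_H\<close> are indexed by cusps
  \<open>cusp_inf g\<close>; at any other point every boundary is 0.\<close>
proof (cases "\<exists>g. q = cusp_inf g")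
  case True
  then obtain g where q: "q = cusp_inf g" by blast
  let ?\<phi> = "\<lambda>(a, b). if cusp_inf b = cusp_inf g then bdry a p else 0"
  have "lin ?\<phi> (square x) = (case x of (a, b) \<Rightarrow> bdry a p * bdry b q)" for x
    by (cases x) (auto simp: square_def lin_add bdry_eq q pt_def)
  then have "lin (\<lambda>(a, b). bdry a p * bdry b q) c = lin (\<lambda>x. lin ?\<phi> (square x)) c"
    by simp
  also have "\<dots> = lin ?\<phi> (lin_fun square c)"
    using assms(1) by (simp add: lin_lin_fun)
  also have "\<dots> = 0" using assms(2) unfolding I_H_iff by blast
  finally show ?thesis .
next
  case False
  then have "bdry b q = 0" for b
    by (metis bdry_eq cusp_S(1) diff_zero pt_def)
  then show ?thesis by (simp add: case_prod_unfold)
qed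

text \<open>Manin's relations, applied in the first variable and then in the second, replace each
  square by an alternating sum of \<open>R\<close> over four pairs of cusps. That sum depends
  linearly on \<open>\<partial> \<otimes> \<partial>\<close>, which kills \<open>c\<close>.\<close>

lemma lin_fun_square_in_I2:
  assumes fin: "fin_supp c" and c: "\<And>p q. lin (\<lambda>(a, b). bdry a p * bdry b q) c = 0"
  shows "lin_fun square c \<in> I2"
proof -
  note K = add_subgroup_I2
  define P where "P b x = path_sum (\<lambda>a. square (a, b)) x" for b x
  define R where "R x y = path_sum (\<lambda>b. P b x) y" for x y
  define Q where "Q = (\<lambda>(a, b). (R (cusp_inf a) (cusp_inf b) - R (cusp_inf a) (cusp_0 b))
    - (R (cusp_0 a) (cusp_inf b) - R (cusp_0 a) (cusp_0 b)))"
  have 1: "square (a, b) - (P b (cusp_inf a) - P b (cusp_0 a)) \<in> I2" for a b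
    unfolding P_def
    by (rule manin_path_sum[OF K])
      (simp_all only: square_add_S_left square_add_U_left translate_gen_in_I2)
  have 2: "P b x - (R x (cusp_inf b) - R x (cusp_0 b)) \<in> I2" for b x
    unfolding R_def
  proof (rule manin_path_sum[OF K])
    fix b
    \<comment> \<open>The relations in the second variable hold edge by edge along the path in the
      first.\<close>
    show "P b x + P (b * S) x \<in> I2" "P b x + P (b * U) x + P (b * U * U) x \<in> I2"
      unfolding P_def path_sum_add[symmetric]
      by (rule add_subgroup_path_sum[OF K],
          simp only: square_add_S_right square_add_U_right translate_gen_in_I2)+
  qed
  have "square x - Q x \<in> I2" for x
  proof -
    obtain a b where x: "x = (a, b)" by (cases x)
    \<comment> \<open>Inserts the intermediate stage, where only the first variable has been
      replaced by paths.\<close>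
    have "s - (u - v) = (s - (p - q)) + ((p - u) - (q - v))" for s u v p q :: "psl \<times> psl \<Rightarrow> int"
      by (simp add: fun_eq_iff)
    then have "square x - Q x = (square (a, b) - (P b (cusp_inf a) - P b (cusp_0 a)))
      + ((P b (cusp_inf a) - (R (cusp_inf a) (cusp_inf b) - R (cusp_inf a) (cusp_0 b)))
        - (P b (cusp_0 a) - (R (cusp_0 a) (cusp_inf b) - R (cusp_0 a) (cusp_0 b))))"
      unfolding x Q_def prod.case by blast
    also have "\<dots> \<in> I2"
      by (intro add_subgroup_add[OF K 1] add_subgroup_diff[OF K 2 2])
    finally show ?thesis .
  qed
  then have "lin_fun (\<lambda>x. square x - Q x) c \<in> I2"
    by (rule add_subgroup_lin_fun[OF K])
  moreover have "lin_fun Q c = 0"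
  proof
    fix z
    define w where "w = (\<lambda>(x, y). R x y z)"
    \<comment> \<open>The product boundary as an element of the free abelian group on pairs of
      cusps; \<open>w\<close> extended linearly takes it to the coordinate of \<open>Q\<close> at
      \<open>z\<close>.\<close>
    define D where "D = (\<lambda>(a, b). delta (cusp_inf a, cusp_inf b) - delta (cusp_inf a, cusp_0 b)
      - (delta (cusp_0 a, cusp_inf b) - delta (cusp_0 a, cusp_0 b)))"
    have fin_D: "fin_supp (D x)" for x by (cases x) (simp add: D_def)
    have "Q x z = lin w (D x)" for x
      by (cases x) (simp add: Q_def D_def w_def lin_diff)
    then have "lin_fun Q c z = lin (\<lambda>x. lin w (D x)) c"
      by (simp add: lin_fun_def)
    also have "\<dots> = lin w (lin_fun D c)"
      using fin fin_D by (simp add: lin_lin_fun)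
    also have "lin_fun D c = 0"
    proof
      fix pq :: "rat option \<times> rat option"
      obtain p q where pq: "pq = (p, q)" by (cases pq)
      have "D x pq = (case x of (a, b) \<Rightarrow> bdry a p * bdry b q)" for x
        by (cases x) (auto simp: D_def pq bdry_eq_delta delta_def)
      then show "lin_fun D c pq = 0 pq" by (simp add: lin_fun_def c)
    qed
    finally show "lin_fun Q c z = 0 z" by (simp add: lin_def)
  qed
  ultimately show ?thesis by (simp add: lin_fun_diff_left)
qed

theorem theorem3:
  shows "I_H \<inter> I_V \<inter> I_D = I2"
proof
  show "I2 \<subseteq> I_H \<inter> I_V \<inter> I_D"
    using I2_subset_I_H I2_subset_I_V I2_subset_I_D by blast
next
  show "I_H \<inter> I_V \<inter> I_D \<subseteq> I2"
  proof
    fix f assume f: "f \<in> I_H \<inter> I_V \<inter> I_D"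
    then obtain c where c: "fin_supp c" "f - lin_fun square c \<in> I2"
      using I_D_subset_square_span unfolding square_span_def by blast
    let ?s = "lin_fun square c"
    have fin: "fin_supp f" "fin_supp ?s" using f c by (simp_all add: I_H_iff)
    \<comment> \<open>Membership in \<open>I_H\<close> passes from \<open>f\<close> to
      \<open>?s\<close>, since their difference lies in \<open>I2\<close> and hence in
      \<open>I_H\<close>.\<close>
    have "f \<in> I_H" "f - ?s \<in> I_H" using f c I2_subset_I_H by blast+
    then have "?s \<in> I_H"
      using fin by (simp add: I_H_iff lin_diff)
    then have "?s \<in> I2"
      by (intro lin_fun_square_in_I2 lin_bdry_bdry_eq_0 c)
    then have "(f - ?s) + ?s \<in> I2" using c(2) by (intro add_subgroup_add[OF add_subgroup_I2])
    then show "f \<in> I2" by simp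
  qed
qed

end
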